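(* Let $V_1,V_2$ be real orthogonal matrices of the same size $m\times m$, let $\alpha=[\alpha_1,\alpha_2]$ with $\alpha_1,\alpha_2\in\mathbb{R}^m$, and let $$N(\alpha)=V_1^T\,\mathrm{diag}(\alpha_1)\,V_1\,V_2^T\,\mathrm{diag}(\alpha_2)\,V_2 .$$ Assume that the entries of $\alpha$ are ordered and take either a positive or a negative value, that is, for $i\in\{1,2\}$, $$\mathrm{diag}(\alpha_i)=H_i\triangleq\begin{pmatrix}\overline{p}_i I_{p_i\times p_i} & 0\\ 0 & -\overline{n}_i I_{n_i\times n_i}\end{pmatrix},$$ for some constants $\overline{p}_i\ge 0$ and $\overline{n}_i\ge 0$, where $p_i$ and $n_i$ denote, respectively, the number of positive and negative entries. Accordingly, consider expressing the matrix product $V_2V_1^T$ in the form $$V_2V_1^T=G=\begin{pmatrix} G_1 & G_2 \\ G_3 & G_4 \end{pmatrix},$$ where $G_1$ is $p_2\times p_1$, $G_2$ is $p_2\times n_1$, $G_3$ is $n_2\times p_1$, and $G_4$ is $n_2\times n_1$. Denote with $c_1,\dots,c_p$ the singular values of either $G_1$ or $G_4$, where $G_1$ is used if $\min(p_1,p_2)\le\min(n_1,n_2)$ and $G_4$ is used otherwise. The singular values are in number of $p=\min(p_1,p_2,n_1,n_2)$, and belong to the range $c_i\in[0,1]$. Define the constants $$\overline{n}=\max(\overline{p}_1\overline{n}_2,\overline{n}_1\overline{p}_2),\quad \overline{p}=\max(\overline{p}_1\overline{p}_2,\overline{n}_1\overline{n}_2),\quad \overline{r}=\sqrt{\overline{p}_1\overline{n}_1\overline{n}_2\overline{p}_2},$$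 $$\breve{n}=\min(\overline{p}_1\overline{n}_2,\overline{n}_1\overline{p}_2),\quad \breve{p}=\min(\overline{p}_1\overline{p}_2,\overline{n}_1\overline{n}_2),$$ $$k_1=\tfrac12(\overline{p}_1+\overline{n}_1)(\overline{p}_2+\overline{n}_2),\quad k_2=\tfrac12(\overline{p}_1\overline{n}_2+\overline{n}_1\overline{p}_2).$$ Then the eigenvalues of the matrix $N(\alpha)$ are known in closed form, and we have that: 1) each singular value $c_i$ generates a couple of distinct eigenvalues by the rule $$\lambda_{1,2}(c_i)=k_1c_i^2-k_2\pm\sqrt{(k_1c_i^2-k_2)^2-\overline{r}^2},$$ for a total of $2p$ eigenvalues; 2) the remaining eigenvalues are real-valued, and can be positive with value $\overline{p}$ or $\breve{p}$ (either of the two, but not both), or negative with value $-\overline{n}$ or $-\breve{n}$ (either of the two, but not both).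
   Context: Here $\mathrm{diag}(v)$ is the diagonal matrix with the entries of the vector $v$ on its diagonal, and $I_{k\times k}$ is the $k\times k$ identity matrix. In each $\alpha_i$ the entries equal to $\overline{p}_i$ (the "positive" entries, $p_i$ in number) are listed first, followed by those equal to $-\overline{n}_i$ (the "negative" entries, $n_i$ in number), so that $p_i+n_i=m$; the "positive" or "negative" value is allowed to be zero.
   Formalization: The two eigenvalues generated by c_i are claimed distinct only when (k_1c_i^2-k_2)^2 differs from r̄^2; otherwise the two formulas coincide (e.g. m=2, V_1=V_2=I, p_i=n_i=1, all constants 1) and the value is counted twice. *)

theory Defs
  imports
    Complex_Main
    "HOL-Library.Multiset"
    "HOL-Computational_Algebra.Fundamental_Theorem_Algebra"
    "Jordan_Normal_Form.Char_Poly"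
begin

(* The library's orthogonal_mat only asks for pairwise orthogonal nonzero columns,
   not for normalized ones. *)
definition real_orthogonal_mat :: "nat \<Rightarrow> real mat \<Rightarrow> bool" where
  "real_orthogonal_mat m V \<longleftrightarrow>
     V \<in> carrier_mat m m \<and> transpose_mat V * V = 1\<^sub>m m \<and> V * transpose_mat V = 1\<^sub>m m"

definition diag_of_vec :: "'a :: zero vec \<Rightarrow> 'a mat" where
  "diag_of_vec v = mat_diag (dim_vec v) (\<lambda>i. v $ i)"

definition N_mat :: "real mat \<Rightarrow> real mat \<Rightarrow> real vec \<Rightarrow> real vec \<Rightarrow> real mat" where
  "N_mat V1 V2 \<alpha>1 \<alpha>2 =
     transpose_mat V1 * diag_of_vec \<alpha>1 * V1 * transpose_mat V2 * diag_of_vec \<alpha>2 * V2"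

definition H_mat :: "nat \<Rightarrow> nat \<Rightarrow> real \<Rightarrow> real \<Rightarrow> real mat" where
  "H_mat p n pb nb =
     four_block_mat (pb \<cdot>\<^sub>m 1\<^sub>m p) (0\<^sub>m p n) (0\<^sub>m n p) ((- nb) \<cdot>\<^sub>m 1\<^sub>m n)"

(* Complex eigenvalues of a real matrix, repeated according to algebraic multiplicity. *)
definition eigenvalues_mset :: "real mat \<Rightarrow> complex multiset" where
  "eigenvalues_mset A = proots (char_poly (map_mat complex_of_real A))"

(* An r x c matrix has min r c singular values, counted with multiplicity: the square roots
   of the eigenvalues of the smaller of its two Gram matrices.  That matrix is real symmetric,
   so its characteristic polynomial splits over the reals. *)
definition singular_values :: "real mat \<Rightarrow> real multiset" where
  "singular_values A = image_mset sqrt (proots (char_poly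
     (if dim_col A \<le> dim_row A then transpose_mat A * A else A * transpose_mat A)))"

(* csqrt: the radicand may be negative, giving a complex conjugate pair. *)
definition lambda1 :: "real \<Rightarrow> real \<Rightarrow> real \<Rightarrow> real \<Rightarrow> complex" where
  "lambda1 k1 k2 r c =
     complex_of_real (k1 * c\<^sup>2 - k2) + csqrt (complex_of_real ((k1 * c\<^sup>2 - k2)\<^sup>2 - r\<^sup>2))"

definition lambda2 :: "real \<Rightarrow> real \<Rightarrow> real \<Rightarrow> real \<Rightarrow> complex" where
  "lambda2 k1 k2 r c =
     complex_of_real (k1 * c\<^sup>2 - k2) - csqrt (complex_of_real ((k1 * c\<^sup>2 - k2)\<^sup>2 - r\<^sup>2))"

end

theory Submission
  imports Defs
begin

text \<open>Each diagonal factor has only two eigenvalues, so \<open>V\<^sub>i\<^sup>T diag(\<alpha>\<^sub>i) V\<^sub>i\<close> is a scalar plus a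
  multiple of an orthogonal projection \<open>E * E\<^sup>T\<close>, where the columns of \<open>E\<close> are orthonormal
  (\<open>frame_op\<close>, \<open>H_mat_frame_op\<close>, \<open>frame_op_congruence\<close>). The theorem thus concerns the product
  \<open>(a + (a' - a) P) (b + (b' - b) Q)\<close> for two orthogonal projections \<open>P = E * E\<^sup>T\<close> and \<open>Q = F * F\<^sup>T\<close>
  of ranks \<open>k \<le> l\<close> with \<open>k + l \<le> m\<close>. Geometrically, two such subspaces decompose the space into
  \<open>k\<close> planes, one for each principal angle, and a complement on which \<open>P\<close> vanishes while \<open>Q\<close> is zero
  on \<open>m - l - k\<close> dimensions and the identity on \<open>l - k\<close>; the cosines of the angles are the singular values of \<open>F\<^sup>T * E\<close>.

  The proof obtains the same decomposition at the level of the characteristic polynomial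
  (\<open>char_poly_frame_product\<close>): Sylvester's determinant identity compresses \<open>det (x - M)\<close> to a
  determinant of size \<open>k\<close> in the symmetric matrix \<open>(F\<^sup>T * E)\<^sup>T * (F\<^sup>T * E)\<close>. Each eigenvalue \<open>c\<^sup>2\<close> of
  that matrix contributes the quadratic factor
  \<open>x\<^sup>2 - (a' b + a b' + (a' - a) (b' - b) c\<^sup>2) x + a a' b b'\<close>, whose roots are the two values
  \<open>lambda1\<close> and \<open>lambda2\<close> (\<open>lambda_factorization\<close>), and what is left over is
  \<open>(x - a b)\<close> to the power \<open>m - l - k\<close> times \<open>(x - a b')\<close> to the power \<open>l - k\<close>. These two linear
  factors give the remaining real eigenvalues.

  It remains to choose the projections so that \<open>k + l \<le> m\<close>. Each factor offers two: onto its
  positive eigenspace or onto its negative one. If \<open>E\<close> and \<open>F\<close> span the positive eigenspaces, then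
  \<open>F\<^sup>T * E\<close> is \<open>G1\<close> up to transposition; for the negative ones it is \<open>G4\<close>. Taking the
  sign of the smallest of the four blocks makes the dimensions fit, and swapping
  the two factors by transposition ensures \<open>k \<le> l\<close>.\<close>

section \<open>Determinant identities\<close>

text \<open>Sylvester's determinant identity. Both sides are the determinant of the block matrix with
  identity blocks on the diagonal and \<open>A\<close>, \<open>B\<close> off it, eliminated once from each end.\<close>
lemma det_one_minus_mult_commute:
  fixes A B :: "'a :: idom mat"
  assumes A: "A \<in> carrier_mat m k" and B: "B \<in> carrier_mat k m"
  shows "det (1\<^sub>m m - A * B) = det (1\<^sub>m k - B * A)"
proof -
  let ?X = "four_block_mat (1\<^sub>m m) A B (1\<^sub>m k)"
  let ?L = "four_block_mat (1\<^sub>m m) (0\<^sub>m m k) B (1\<^sub>m k)"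
  let ?R = "four_block_mat (1\<^sub>m m) A (0\<^sub>m k m) (1\<^sub>m k - B * A)"
  let ?S = "four_block_mat (1\<^sub>m m - A * B) A (0\<^sub>m k m) (1\<^sub>m k)"
  have AB: "A * B \<in> carrier_mat m m" and BA: "B * A \<in> carrier_mat k k"
    using A B by auto
  have L: "?L \<in> carrier_mat (m + k) (m + k)"
    and R: "?R \<in> carrier_mat (m + k) (m + k)"
    and S: "?S \<in> carrier_mat (m + k) (m + k)" using A B AB BA by auto
  have dL: "det ?L = 1"
    using det_four_block_mat_upper_right_zero[OF one_carrier_mat refl B one_carrier_mat] by simp
  have BA': "1\<^sub>m k - B * A \<in> carrier_mat k k" and AB': "1\<^sub>m m - A * B \<in> carrier_mat m m"
    by (rule minus_carrier_mat[OF BA], rule minus_carrier_mat[OF AB])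
  have dR: "det ?R = det (1\<^sub>m k - B * A)"
    using det_four_block_mat_lower_left_zero[OF one_carrier_mat A refl BA'] by simp
  have dS: "det ?S = det (1\<^sub>m m - A * B)"
    using det_four_block_mat_lower_left_zero[OF AB' A refl one_carrier_mat] by simp
  have XLR: "?X = ?L * ?R"
    by (subst mult_four_block_mat[of _ m m _ k _ k _ _ m _ k])
       (use A B AB BA in \<open>auto intro!: cong_four_block_mat\<close>)
  have XSL: "?X = ?S * ?L"
    by (subst mult_four_block_mat[of _ m m _ k _ k _ _ m _ k])
       (use A B AB BA in \<open>auto intro!: cong_four_block_mat\<close>)
  show ?thesis
    using det_mult[OF L R] det_mult[OF S L] XLR XSL dL dR dS by simp
qed

lemma poly_char_poly:
  fixes A :: "'a :: field mat"
  assumes A: "A \<in> carrier_mat n n"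
  shows "poly (char_poly A) x = det (x \<cdot>\<^sub>m 1\<^sub>m n - A)"
proof -
  have "- char_matrix A x = x \<cdot>\<^sub>m 1\<^sub>m n - A"
    by (rule eq_matI) (use A in \<open>auto simp: char_matrix_def\<close>)
  then show ?thesis using char_poly_matrix[OF A, of x] by simp
qed

lemma scalar_prod_mult_mat_vec_self:
  fixes A :: "real mat"
  assumes A: "A \<in> carrier_mat n k" and v: "v \<in> carrier_vec k"
  shows "(A *\<^sub>v v) \<bullet> (A *\<^sub>v v) = v \<bullet> ((A\<^sup>T * A) *\<^sub>v v)"
proof -
  have Av: "A *\<^sub>v v \<in> carrier_vec n" using A v by simp
  have "(A *\<^sub>v v) \<bullet> (A *\<^sub>v v) = (A\<^sup>T *\<^sub>v (A *\<^sub>v v)) \<bullet> v"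
    using transpose_vec_mult_scalar[OF A v Av] by simp
  also have "\<dots> = v \<bullet> (A\<^sup>T *\<^sub>v (A *\<^sub>v v))"
    by (rule comm_scalar_prod[of _ k]) (use A v Av in auto)
  also have "A\<^sup>T *\<^sub>v (A *\<^sub>v v) = (A\<^sup>T * A) *\<^sub>v v"
    using A v by (intro assoc_mult_mat_vec[symmetric]) auto
  finally show ?thesis .
qed

section \<open>Real symmetric matrices\<close>

text \<open>Pairing an eigenvector \<open>v\<close> with its conjugate \<open>w\<close> and moving \<open>A\<close> across the pairing
  shows \<open>cnj z * (w \<bullet> v) = z * (w \<bullet> v)\<close>, and \<open>w \<bullet> v\<close> is the sum of the squared moduli of the
  entries of \<open>v\<close>.\<close>
lemma real_symmetric_eigenvalue_real:
  fixes A :: "real mat"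
  assumes A: "A \<in> carrier_mat n n" and sym: "A\<^sup>T = A"
    and ev: "eigenvalue (map_mat complex_of_real A) z"
  shows "z \<in> \<real>"
proof -
  let ?A = "map_mat complex_of_real A"
  have cA: "?A \<in> carrier_mat n n" using A by simp
  have "?A\<^sup>T = map_mat complex_of_real (A\<^sup>T)" by (rule eq_matI) auto
  then have symc: "?A\<^sup>T = ?A" by (simp add: sym)
  obtain v where v: "v \<in> carrier_vec n" and v0: "v \<noteq> 0\<^sub>v n" and Av: "?A *\<^sub>v v = z \<cdot>\<^sub>v v"
    using ev cA by (auto simp: eigenvalue_def eigenvector_def)
  define w where "w = map_vec cnj v"
  have w: "w \<in> carrier_vec n" using v by (simp add: w_def)
  have Aw: "?A *\<^sub>v w = cnj z \<cdot>\<^sub>v w"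
  proof (rule eq_vecI)
    fix i assume "i < dim_vec (cnj z \<cdot>\<^sub>v w)"
    then have i: "i < n" using w by simp
    have "(?A *\<^sub>v w) $ i = cnj ((?A *\<^sub>v v) $ i)"
      using i A v by (simp add: w_def scalar_prod_def)
    then show "(?A *\<^sub>v w) $ i = (cnj z \<cdot>\<^sub>v w) $ i"
      using i v by (simp add: Av w_def)
  qed (use A w in simp)
  have "cnj z * (w \<bullet> v) = (?A\<^sup>T *\<^sub>v w) \<bullet> v"
    using v w by (simp add: symc Aw)
  also have "\<dots> = w \<bullet> (?A *\<^sub>v v)"
    by (rule transpose_vec_mult_scalar[OF cA v w])
  also have "\<dots> = z * (w \<bullet> v)" using v w by (simp add: Av)
  finally have eq: "cnj z * (w \<bullet> v) = z * (w \<bullet> v)" .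
  have wv: "w \<bullet> v = of_real (\<Sum>i<n. (cmod (v $ i))\<^sup>2)"
    using v by (simp add: w_def scalar_prod_def lessThan_atLeast0 mult.commute flip: complex_norm_square)
  obtain i where i: "i < n" "v $ i \<noteq> 0"
    using v v0 by (metis carrier_vecD eq_vecI index_zero_vec)
  have "(\<Sum>i<n. (cmod (v $ i))\<^sup>2) > 0"
    by (rule sum_pos2[of _ i]) (use i in auto)
  then have "cnj z = z" using eq wv by (metis less_irrefl mult_right_cancel of_real_eq_0_iff)
  then show ?thesis by (metis Reals_cnj_iff)
qed

text \<open>The characteristic polynomial splits over the complex numbers, and each of its roots is an
  eigenvalue, hence real.\<close>
lemma real_symmetric_char_poly_splits:
  fixes A :: "real mat"
  assumes A: "A \<in> carrier_mat n n" and sym: "A\<^sup>T = A"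
  shows "char_poly A = (\<Prod>x\<in>#proots (char_poly A). [:- x, 1:])"
    and "size (proots (char_poly A)) = n"
proof -
  interpret cp: map_poly_comm_ring_hom complex_of_real ..
  let ?A = "map_mat complex_of_real A"
  have cA: "?A \<in> carrier_mat n n" using A by simp
  obtain as where as: "char_poly ?A = (\<Prod>a\<leftarrow>as. [:- a, 1:])" and len: "length as = n"
    using char_poly_factorized[OF cA] by blast
  have "a \<in> \<real>" if "a \<in> set as" for a
  proof -
    have "poly (char_poly ?A) a = 0"
      unfolding as using that by (auto simp: poly_prod_list prod_list_zero_iff)
    then show ?thesis
      using real_symmetric_eigenvalue_real[OF A sym] eigenvalue_root_char_poly[OF cA] by blast
  qed
  then have re: "map (\<lambda>a. complex_of_real (Re a)) as = as" by (auto intro!: map_idI)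
  define bs where "bs = map Re as"
  have "map_poly complex_of_real (char_poly A) = char_poly ?A"
    using A by (simp add: of_real_hom.char_poly_hom)
  also have "\<dots> = (\<Prod>b\<leftarrow>bs. [:- complex_of_real b, 1:])"
    unfolding as bs_def by (subst (1) re[symmetric]) (simp add: o_def)
  also have "\<dots> = map_poly complex_of_real (\<Prod>b\<leftarrow>bs. [:- b, 1:])"
    by (induction bs) (simp_all add: cp.hom_mult del: mult_pCons_left)
  finally have fac: "char_poly A = (\<Prod>b\<leftarrow>bs. [:- b, 1:])"
    by (simp add: poly_eq_iff coeff_map_poly)
  have roots: "proots (char_poly A) = mset bs"
    unfolding fac
  proof (induction bs)
    case (Cons b bs)
    have "(\<Prod>b\<leftarrow>bs. [:- b, 1:]) \<noteq> 0" by (auto simp: prod_list_zero_iff)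
    then show ?case
      using Cons by (simp add: proots_mult del: mult_pCons_left)
  qed simp
  show "char_poly A = (\<Prod>x\<in>#proots (char_poly A). [:- x, 1:])"
    unfolding roots by (simp add: fac prod_mset_prod_list flip: mset_map)
  show "size (proots (char_poly A)) = n"
    by (simp add: roots bs_def len)
qed

text \<open>The homogeneous form of the factorization of the characteristic polynomial, so that it can
  be used when \<open>u\<close> and \<open>v\<close> are themselves functions of a spectral parameter and \<open>v\<close> may vanish.\<close>
lemma real_symmetric_det_pencil:
  fixes A :: "real mat"
  assumes A: "A \<in> carrier_mat n n" and sym: "A\<^sup>T = A"
  shows "det (u \<cdot>\<^sub>m 1\<^sub>m n - v \<cdot>\<^sub>m A) = (\<Prod>x\<in>#proots (char_poly A). u - v * x)"
proof (cases "v = 0")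
  case True
  have "u \<cdot>\<^sub>m 1\<^sub>m n - v \<cdot>\<^sub>m A = u \<cdot>\<^sub>m 1\<^sub>m n"
    by (rule eq_matI) (use A True in auto)
  then show ?thesis
    using real_symmetric_char_poly_splits(2)[OF A sym] True by (simp add: prod_mset_constant)
next
  case False
  let ?R = "proots (char_poly A)"
  have sz: "size ?R = n" by (rule real_symmetric_char_poly_splits(2)[OF A sym])
  have "u \<cdot>\<^sub>m 1\<^sub>m n - v \<cdot>\<^sub>m A = v \<cdot>\<^sub>m ((u / v) \<cdot>\<^sub>m 1\<^sub>m n - A)"
    by (rule eq_matI) (use A False in \<open>auto simp: field_simps\<close>)
  then have "det (u \<cdot>\<^sub>m 1\<^sub>m n - v \<cdot>\<^sub>m A) = v ^ n * poly (char_poly A) (u / v)"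
    using A by (simp add: poly_char_poly)
  also have "poly (char_poly A) (u / v) = (\<Prod>x\<in>#?R. u / v - x)"
    by (subst real_symmetric_char_poly_splits(1)[OF A sym]) (simp add: poly_prod_mset image_mset.compositionality o_def)
  also have "v ^ n * \<dots> = (\<Prod>x\<in>#?R. v * (u / v - x))"
    by (simp add: prod_mset.distrib prod_mset_constant sz)
  also have "\<dots> = (\<Prod>x\<in>#?R. u - v * x)"
    using False by (simp add: right_diff_distrib)
  finally show ?thesis .
qed

section \<open>Products of two symmetric matrices with two eigenvalues each\<close>

text \<open>When the columns of \<open>E\<close> are orthonormal, \<open>E * E\<^sup>T\<close> is the orthogonal projection onto their
  span, and this is the symmetric matrix with eigenvalue \<open>a'\<close> on that span and \<open>a\<close> on its orthogonal
  complement.\<close>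
definition frame_op :: "real mat \<Rightarrow> real \<Rightarrow> real \<Rightarrow> real mat" where
  "frame_op E a' a = a \<cdot>\<^sub>m 1\<^sub>m (dim_row E) + (a' - a) \<cdot>\<^sub>m (E * E\<^sup>T)"

text \<open>For an eigenvector \<open>v\<close> put \<open>w = E v\<close>, which has the norm of \<open>v\<close>. The projection of \<open>w\<close> onto
  the span of \<open>F\<close> has squared norm \<open>x * (v \<bullet> v)\<close>, and this lies between zero and the squared norm
  of \<open>w\<close> by Pythagoras. So \<open>x\<close> is the squared cosine of a principal angle between the two spans.\<close>
lemma singular_value_square_bounds:
  fixes E F :: "real mat"
  assumes E: "E \<in> carrier_mat m k" and F: "F \<in> carrier_mat m l"
    and EE: "E\<^sup>T * E = 1\<^sub>m k" and FF: "F\<^sup>T * F = 1\<^sub>m l"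
    and x: "x \<in># proots (char_poly ((F\<^sup>T * E)\<^sup>T * (F\<^sup>T * E)))"
  shows "0 \<le> x \<and> x \<le> 1"
proof -
  let ?X = "F\<^sup>T * E"
  have X: "?X \<in> carrier_mat l k" using E F by auto
  have C: "?X\<^sup>T * ?X \<in> carrier_mat k k"
    by (rule mult_carrier_mat[OF _ X]) (use E F in simp)
  have "poly (char_poly (?X\<^sup>T * ?X)) x = 0"
    using x by (cases "char_poly (?X\<^sup>T * ?X) = 0") auto
  then have "eigenvalue (?X\<^sup>T * ?X) x" using eigenvalue_root_char_poly[OF C] by blast
  then obtain v where v: "v \<in> carrier_vec k" "v \<noteq> 0\<^sub>v k" and Cv: "(?X\<^sup>T * ?X) *\<^sub>v v = x \<cdot>\<^sub>v v"
    using C by (auto simp: eigenvalue_def eigenvector_def)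
  have vv: "v \<bullet> v > 0"
  proof -
    obtain i where "i < k" "v $ i \<noteq> 0"
      using v by (metis carrier_vecD eq_vecI index_zero_vec)
    then show ?thesis
      using v(1) unfolding scalar_prod_def
      by (intro sum_pos2[of _ i]) (auto simp: zero_less_mult_iff neq_iff)
  qed
  define w where "w = E *\<^sub>v v"
  define u where "u = F\<^sup>T *\<^sub>v w"
  have w: "w \<in> carrier_vec m" using E v by (simp add: w_def)
  have u: "u \<in> carrier_vec l" using F w by (simp add: u_def)
  have Fu: "F *\<^sub>v u \<in> carrier_vec m" using F u by simp
  have ww: "w \<bullet> w = v \<bullet> v" using scalar_prod_mult_mat_vec_self[OF E v(1)] v by (simp add: EE w_def)
  have Xv: "?X *\<^sub>v v = u" using E F v by (simp add: u_def w_def)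
  have uu: "u \<bullet> u = x * (v \<bullet> v)" using scalar_prod_mult_mat_vec_self[OF X v(1)] v by (simp add: Xv Cv)
  have FuFu: "(F *\<^sub>v u) \<bullet> (F *\<^sub>v u) = u \<bullet> u" using scalar_prod_mult_mat_vec_self[OF F u] u by (simp add: FF)
  have wFu: "w \<bullet> (F *\<^sub>v u) = u \<bullet> u"
    using transpose_vec_mult_scalar[OF F u w] by (simp add: u_def)
  have Fuw: "(F *\<^sub>v u) \<bullet> w = u \<bullet> u"
    using comm_scalar_prod[OF Fu w] wFu by simp
  have "(w - F *\<^sub>v u) \<bullet> (w - F *\<^sub>v u) = w \<bullet> w - u \<bullet> u"
    using w Fu by (simp add: minus_scalar_prod_distrib[of _ m] scalar_prod_minus_distrib[of _ m] FuFu wFu Fuw)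
  moreover have "(w - F *\<^sub>v u) \<bullet> (w - F *\<^sub>v u) \<ge> 0" "u \<bullet> u \<ge> 0"
    by (simp_all add: scalar_prod_def sum_nonneg)
  ultimately show ?thesis using vv by (simp add: ww uu zero_le_mult_iff mult_le_cancel_right1)
qed

lemma real_poly_eqI_cofinite:
  fixes p q :: "real poly"
  assumes "finite S" and "\<And>x. x \<notin> S \<Longrightarrow> poly p x = poly q x"
  shows "p = q"
proof (rule ccontr)
  assume "p \<noteq> q"
  then have "finite {x. poly (p - q) x = 0}" by (intro poly_roots_finite) simp
  moreover have "UNIV \<subseteq> S \<union> {x. poly (p - q) x = 0}" using assms(2) by auto
  ultimately show False using assms(1) infinite_UNIV_char_0
    by (metis finite_Un finite_subset)
qed

text \<open>Write \<open>P = E * E\<^sup>T\<close> and \<open>Q = F * F\<^sup>T\<close>. Unless \<open>x\<close> is \<open>a * b\<close> or \<open>a * b'\<close>, the matrix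
  \<open>W = x - a (b + (b' - b) Q)\<close> is an invertible combination of \<open>1\<close> and \<open>Q\<close>, and \<open>x - M\<close> differs from
  it by a matrix that factors through the \<open>k\<close>-dimensional span of \<open>E\<close>. Sylvester's identity
  therefore reduces the determinant to size \<open>k\<close>, where \<open>Q\<close> enters only through the compression
  \<open>E\<^sup>T * Q * E\<close>. That matrix is symmetric, so the remaining determinant is a product over its
  eigenvalues. The denominators introduced by the inverse of \<open>W\<close> are cancelled by \<open>det W\<close>, because
  \<open>k \<le> l\<close> and \<open>k + l \<le> m\<close>; polynomials that agree at almost all points are equal.\<close>
lemma char_poly_frame_product:
  fixes E F :: "real mat"
  assumes E: "E \<in> carrier_mat m k" and F: "F \<in> carrier_mat m l"
    and FF: "F\<^sup>T * F = 1\<^sub>m l" and EE: "E\<^sup>T * E = 1\<^sub>m k"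
    and kl: "k \<le> l" and klm: "k + l \<le> m"
  shows "char_poly (frame_op E a' a * frame_op F b' b) =
    [:- (a * b), 1:] ^ (m - l - k) * [:- (a * b'), 1:] ^ (l - k) *
    (\<Prod>x\<in>#proots (char_poly ((F\<^sup>T * E)\<^sup>T * (F\<^sup>T * E))).
      [:a * a' * b * b', - (a' * b + a * b' + (a' - a) * (b' - b) * x), 1:])"
    (is "char_poly ?M = _ * _ * (\<Prod>x\<in>#?R. ?q x)")
proof (rule real_poly_eqI_cofinite)
  show "finite {a * b, a * b'}" by simp
  fix x assume x: "x \<notin> {a * b, a * b'}"
  let ?C = "(F\<^sup>T * E)\<^sup>T * (F\<^sup>T * E)"
  define s t where "s = a' - a" and "t = b' - b"
  define y z where "y = x - a * b" and "z = x - a * b'"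
  have yz: "y \<noteq> 0" "z \<noteq> 0" using x by (auto simp: y_def z_def)
  define P Q where "P = E * E\<^sup>T" and "Q = F * F\<^sup>T"
  \<comment> \<open>\<open>y\<close> and \<open>z\<close> are the eigenvalues of \<open>W\<close> off and on the span of \<open>F\<close>, and \<open>R\<close> is the matrix
    \<open>(b + t Q) inverse W\<close>, with eigenvalues \<open>b / y\<close> and \<open>b' / z\<close>, so that \<open>b + t Q = R W\<close>.\<close>
  define r where "r = b' / z - b / y"
  define W R where "W = y \<cdot>\<^sub>m 1\<^sub>m m - (a * t) \<cdot>\<^sub>m Q" and "R = (b / y) \<cdot>\<^sub>m 1\<^sub>m m + r \<cdot>\<^sub>m Q"
  have P: "P \<in> carrier_mat m m" and Q: "Q \<in> carrier_mat m m" using E F by (auto simp: P_def Q_def)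
  have W: "W \<in> carrier_mat m m" and R: "R \<in> carrier_mat m m" using Q by (auto simp: W_def R_def)
  have ET: "E\<^sup>T \<in> carrier_mat k m" and FT: "F\<^sup>T \<in> carrier_mat l m" using E F by auto
  have QQ: "Q * Q = Q"
  proof -
    have "Q * Q = F * (F\<^sup>T * (F * F\<^sup>T))"
      unfolding Q_def by (rule assoc_mult_mat[OF F FT]) (use F in auto)
    also have "F\<^sup>T * (F * F\<^sup>T) = (F\<^sup>T * F) * F\<^sup>T"
      by (rule assoc_mult_mat[symmetric, OF FT F FT])
    finally show ?thesis using FT by (simp add: FF Q_def)
  qed
  have M: "?M \<in> carrier_mat m m" using E F by (auto simp: frame_op_def)

  have RW: "R * W = b \<cdot>\<^sub>m 1\<^sub>m m + t \<cdot>\<^sub>m Q"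
  proof -
    have "R * W = (b / y) \<cdot>\<^sub>m W + r \<cdot>\<^sub>m (Q * W)"
      unfolding R_def using Q W
      by (subst add_mult_distrib_mat[of _ m m]) (auto simp: mult_smult_assoc_mat[of _ m m _ m])
    also have "Q * W = y \<cdot>\<^sub>m Q - (a * t) \<cdot>\<^sub>m Q"
      unfolding W_def using Q
      by (subst mult_minus_distrib_mat[of _ m m]) (auto simp: mult_smult_distrib[of _ m m _ m] QQ)
    finally have *: "R * W = (b / y) \<cdot>\<^sub>m W + r \<cdot>\<^sub>m (y \<cdot>\<^sub>m Q - (a * t) \<cdot>\<^sub>m Q)" .
    have key: "r * (y - a * t) - b / y * (a * t) = t"
      using yz unfolding r_def by (simp add: field_simps) (simp add: y_def z_def t_def algebra_simps)
    show ?thesis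
      unfolding *
    proof (rule eq_matI, goal_cases)
      case (1 i j)
      then have ij: "i < m" "j < m" using Q by auto
      define d q where "d = (1\<^sub>m m :: real mat) $$ (i, j)" and "q = Q $$ (i, j)"
      have "b / y * (y * d - a * t * q) + r * (y * q - a * t * q)
          = (b / y * y) * d + (r * (y - a * t) - b / y * (a * t)) * q"
        by (simp add: algebra_simps)
      also have "\<dots> = b * d + t * q" using yz(1) unfolding key by simp
      finally show ?case using ij Q by (simp add: W_def d_def q_def del: index_one_mat(1))
    qed (use Q W in auto)
  qed
  have F_op: "frame_op F b' b = R * W"
    unfolding RW using F by (simp add: frame_op_def t_def Q_def)
  have E_op: "frame_op E a' a = a \<cdot>\<^sub>m 1\<^sub>m m + s \<cdot>\<^sub>m P"
    using E by (simp add: frame_op_def s_def P_def)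
  have PR: "P * R \<in> carrier_mat m m" using P R by auto
  have RWc: "R * W \<in> carrier_mat m m" using R W by auto
  let ?T = "1\<^sub>m m - (s \<cdot>\<^sub>m E) * (E\<^sup>T * R)"
  have T: "?T \<in> carrier_mat m m" by (rule minus_carrier_mat) (use E R in auto)
  have "x \<cdot>\<^sub>m 1\<^sub>m m - ?M = ?T * W"
  proof -
    have "?M = a \<cdot>\<^sub>m (R * W) + s \<cdot>\<^sub>m (P * (R * W))"
      unfolding E_op F_op using P RWc
      by (subst add_mult_distrib_mat[of _ m m]) (auto simp: mult_smult_assoc_mat[of _ m m _ m])
    moreover have "?T = 1\<^sub>m m - s \<cdot>\<^sub>m (P * R)"
      unfolding P_def using E ET R by (simp add: mult_smult_assoc_mat[of _ m k _ m] assoc_mult_mat[of _ m k _ m _ m])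
    moreover have "(1\<^sub>m m - s \<cdot>\<^sub>m (P * R)) * W = W - s \<cdot>\<^sub>m (P * (R * W))"
      using PR W P R by (subst minus_mult_distrib_mat[of _ m m])
        (auto simp: mult_smult_assoc_mat[of _ m m _ m] assoc_mult_mat[of _ m m _ m _ m])
    moreover have Wx: "W = x \<cdot>\<^sub>m 1\<^sub>m m - a \<cdot>\<^sub>m (R * W)"
      unfolding RW by (rule eq_matI) (use Q in \<open>auto simp: W_def y_def algebra_simps\<close>)
    moreover have "x \<cdot>\<^sub>m 1\<^sub>m m - (a \<cdot>\<^sub>m (R * W) + s \<cdot>\<^sub>m (P * (R * W))) = W - s \<cdot>\<^sub>m (P * (R * W))"
    proof -
      define Y where "Y = R * W"
      define Z where "Z = P * Y"
      have YZ: "Y \<in> carrier_mat m m" "Z \<in> carrier_mat m m"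
        using RWc P by (auto simp: Y_def Z_def)
      have "W = x \<cdot>\<^sub>m 1\<^sub>m m - a \<cdot>\<^sub>m Y" using Wx by (simp add: Y_def)
      then show ?thesis
        unfolding Y_def[symmetric] Z_def[symmetric]
        by (intro eq_matI) (use YZ in auto)
    qed
    ultimately show ?thesis by simp
  qed
  then have "det (x \<cdot>\<^sub>m 1\<^sub>m m - ?M) = det ?T * det W"
    using det_mult[OF T W] by simp
  also have "det ?T = det (1\<^sub>m k - (E\<^sup>T * R) * (s \<cdot>\<^sub>m E))"
    by (rule det_one_minus_mult_commute) (use E R in auto)
  also have "1\<^sub>m k - (E\<^sup>T * R) * (s \<cdot>\<^sub>m E) = (1 / (y * z)) \<cdot>\<^sub>m
      (((x - a' * b) * z) \<cdot>\<^sub>m 1\<^sub>m k - (s * t * x) \<cdot>\<^sub>m ?C)"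
  proof -
    have QE: "Q * E \<in> carrier_mat m k" using Q E by auto
    have C_eq: "?C = E\<^sup>T * (Q * E)"
    proof -
      have "?C = (E\<^sup>T * F) * (F\<^sup>T * E)"
        using transpose_mult[OF FT E] by simp
      also have "\<dots> = E\<^sup>T * (F * (F\<^sup>T * E))"
        by (rule assoc_mult_mat[OF ET F]) (use FT E in auto)
      also have "F * (F\<^sup>T * E) = Q * E"
        unfolding Q_def by (rule assoc_mult_mat[symmetric, OF F FT E])
      finally show ?thesis .
    qed
    have "(E\<^sup>T * R) * (s \<cdot>\<^sub>m E) = s \<cdot>\<^sub>m (E\<^sup>T * (R * E))"
      using mult_smult_distrib[OF mult_carrier_mat[OF ET R] E] assoc_mult_mat[OF ET R E] by simp
    also have "R * E = (b / y) \<cdot>\<^sub>m E + r \<cdot>\<^sub>m (Q * E)"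
      unfolding R_def using Q E
      by (subst add_mult_distrib_mat[of _ m m]) (auto simp: mult_smult_assoc_mat[of _ m m _ k])
    also have "E\<^sup>T * \<dots> = (b / y) \<cdot>\<^sub>m 1\<^sub>m k + r \<cdot>\<^sub>m ?C"
      unfolding C_eq
      using mult_add_distrib_mat[OF ET smult_carrier_mat[OF E] smult_carrier_mat[OF QE], of "b / y" r]
        mult_smult_distrib[OF ET E] mult_smult_distrib[OF ET QE] by (simp only: EE)
    finally have *: "(E\<^sup>T * R) * (s \<cdot>\<^sub>m E) = s \<cdot>\<^sub>m ((b / y) \<cdot>\<^sub>m 1\<^sub>m k + r \<cdot>\<^sub>m ?C)" .
    \<comment> \<open>\<open>key1\<close> and \<open>key2\<close> clear the denominators: \<open>y - s b = x - a' b\<close> and \<open>b' y - b z = t x\<close>.\<close>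
    have key1: "1 - s * (b / y) = 1 / (y * z) * ((x - a' * b) * z)"
      using yz by (simp add: field_simps) (simp add: y_def s_def algebra_simps)
    have key2: "s * r = 1 / (y * z) * (s * t * x)"
    proof -
      have "b' * y - b * z = t * x" by (simp add: y_def z_def t_def algebra_simps)
      moreover have "r = (b' * y - b * z) / (y * z)" using yz by (simp add: r_def field_simps)
      ultimately show ?thesis by simp
    qed
    define C where "C = ?C"
    have C: "C \<in> carrier_mat k k"
      unfolding C_def by (rule mult_carrier_mat[of _ k l]) (use E F in simp_all)
    show ?thesis
      unfolding * C_def[symmetric]
    proof (rule eq_matI, goal_cases)
      case (1 i j)
      then have ij: "i < k" "j < k" using C by auto
      define d q where "d = (1\<^sub>m k :: real mat) $$ (i, j)" and "q = C $$ (i, j)"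
      have "d - s * (b / y * d + r * q) = (1 - s * (b / y)) * d - (s * r) * q"
        by (simp add: algebra_simps)
      also have "\<dots> = 1 / (y * z) * ((x - a' * b) * z * d - s * t * x * q)"
        unfolding key1 key2 by (simp add: algebra_simps)
      finally show ?case using ij C by (simp add: d_def q_def del: index_one_mat(1))
    qed (use C in auto)
  qed
  also have "det \<dots> = (1 / (y * z)) ^ k * (\<Prod>c\<in>#?R. (x - a' * b) * z - s * t * x * c)"
  proof -
    have X: "F\<^sup>T * E \<in> carrier_mat l k" using E F by auto
    have C: "?C \<in> carrier_mat k k"
      by (rule mult_carrier_mat[OF _ X]) (use E F in simp)
    have "?C\<^sup>T = ?C" using transpose_mult[of "(F\<^sup>T * E)\<^sup>T" k l "F\<^sup>T * E" k] X by simp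
    from real_symmetric_det_pencil[OF C this] show ?thesis
      using E by simp
  qed
  also have "det W = y ^ m * (z / y) ^ l"
  proof -
    have "W = y \<cdot>\<^sub>m (1\<^sub>m m - ((a * t / y) \<cdot>\<^sub>m F) * F\<^sup>T)"
      unfolding W_def Q_def using F FT yz
      by (intro eq_matI) (auto simp: mult_smult_assoc_mat[of _ m l _ m] right_diff_distrib simp del: index_mult_mat(1))
    also have "det \<dots> = y ^ m * det (1\<^sub>m m - ((a * t / y) \<cdot>\<^sub>m F) * F\<^sup>T)"
      using F by simp
    also have "det (1\<^sub>m m - ((a * t / y) \<cdot>\<^sub>m F) * F\<^sup>T) = det (1\<^sub>m l - F\<^sup>T * ((a * t / y) \<cdot>\<^sub>m F))"
      by (rule det_one_minus_mult_commute) (use F in auto)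
    also have "1\<^sub>m l - F\<^sup>T * ((a * t / y) \<cdot>\<^sub>m F) = (z / y) \<cdot>\<^sub>m 1\<^sub>m l"
    proof -
      have "1 - a * t / y = z / y" using yz by (simp add: field_simps) (simp add: y_def z_def t_def algebra_simps)
      moreover have "F\<^sup>T * ((a * t / y) \<cdot>\<^sub>m F) = (a * t / y) \<cdot>\<^sub>m 1\<^sub>m l"
        using mult_smult_distrib[OF FT F] FF by simp
      ultimately show ?thesis by (auto intro!: eq_matI)
    qed
    finally show ?thesis by simp
  qed
  finally have "poly (char_poly ?M) x =
      (1 / (y * z)) ^ k * (\<Prod>c\<in>#?R. (x - a' * b) * z - s * t * x * c) * (y ^ m * (z / y) ^ l)"
    using poly_char_poly[OF M] by simp
  also have "\<dots> = y ^ (m - l - k) * z ^ (l - k) * (\<Prod>c\<in>#?R. (x - a' * b) * z - s * t * x * c)"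
  proof -
    have "y ^ m = y ^ (m - l - k) * y ^ l * y ^ k" "z ^ l = z ^ (l - k) * z ^ k"
      using kl klm by (simp_all flip: power_add)
    then show ?thesis using yz by (simp add: power_divide power_mult_distrib)
  qed
  also have "(\<Prod>c\<in>#?R. (x - a' * b) * z - s * t * x * c) = (\<Prod>c\<in>#?R. poly (?q c) x)"
    by (intro arg_cong[of _ _ prod_mset] image_mset_cong) (simp add: z_def s_def t_def algebra_simps)
  finally show "poly (char_poly ?M) x = poly ([:- (a * b), 1:] ^ (m - l - k) * [:- (a * b'), 1:] ^ (l - k) *
      (\<Prod>c\<in>#?R. ?q c)) x"
    by (simp add: y_def z_def poly_prod_mset image_mset.compositionality o_def poly_power)
qed

section \<open>The pair of eigenvalues of each singular value\<close>

text \<open>By Vieta: the two values have sum \<open>2 * (k1 * c\<^sup>2 - k2)\<close> and product \<open>r\<^sup>2\<close>, whatever the sign of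
  the radicand.\<close>
lemma lambda_factorization:
  assumes "r\<^sup>2 = d" "b = 2 * (k1 * c\<^sup>2 - k2)"
  shows "[:complex_of_real d, - complex_of_real b, 1:] = [:- lambda1 k1 k2 r c, 1:] * [:- lambda2 k1 k2 r c, 1:]"
proof -
  define h where "h = k1 * c\<^sup>2 - k2"
  define w where "w = csqrt (complex_of_real (h\<^sup>2 - r\<^sup>2))"
  have l: "lambda1 k1 k2 r c = of_real h + w" "lambda2 k1 k2 r c = of_real h - w"
    by (simp_all add: lambda1_def lambda2_def h_def w_def)
  have "w * w = complex_of_real (h\<^sup>2 - r\<^sup>2)"
    unfolding w_def by (metis power2_csqrt power2_eq_square)
  then have "(of_real h + w) * (of_real h - w) = complex_of_real d"
    by (simp add: algebra_simps power2_eq_square flip: assms(1))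
  moreover have "complex_of_real b = (of_real h + w) + (of_real h - w)"
    by (simp add: assms(2) h_def)
  moreover have "[:- u, 1:] * [:- v, 1:] = [:u * v, - (u + v), 1:]" for u v :: complex
    by simp
  ultimately show ?thesis
    unfolding l by (simp only:)
qed

lemma lambda_distinct:
  assumes "(k1 * c\<^sup>2 - k2)\<^sup>2 \<noteq> r\<^sup>2"
  shows "lambda1 k1 k2 r c \<noteq> lambda2 k1 k2 r c"
proof -
  have "csqrt (complex_of_real ((k1 * c\<^sup>2 - k2)\<^sup>2 - r\<^sup>2)) \<noteq> 0"
    using assms by (metis csqrt_eq_0 eq_iff_diff_eq_0 of_real_eq_0_iff)
  moreover have "w = 0" if "u + w = u - w" for u w :: complex
    using that by (simp add: add_eq_0_iff2 eq_neg_iff_add_eq_0 flip: mult_2)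
  ultimately show ?thesis unfolding lambda1_def lambda2_def by blast
qed

lemma frame_op_carrier: "E \<in> carrier_mat m k \<Longrightarrow> frame_op E a' a \<in> carrier_mat m m"
  by (auto simp: frame_op_def)

lemma frame_op_symmetric:
  assumes E: "E \<in> carrier_mat m k"
  shows "(frame_op E a' a)\<^sup>T = frame_op E a' a"
proof -
  define P where "P = E * E\<^sup>T"
  have P: "P \<in> carrier_mat m m" using E by (auto simp: P_def)
  have "P\<^sup>T = P" using transpose_mult[OF E, of "E\<^sup>T" m] E by (simp add: P_def)
  then have "P $$ (i, j) = P $$ (j, i)" if "i < m" "j < m" for i j
    using that P index_transpose_mat(1)[of i P j] by simp
  then show ?thesis
    using P E by (intro eq_matI) (auto simp: frame_op_def simp flip: P_def)
qed

text \<open>The order of the two factors does not matter because they are symmetric: transposing the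
  product swaps them and preserves the characteristic polynomial. So the frame \<open>E\<close> with fewer
  columns may belong to either factor.\<close>
lemma eigenvalues_frame_product:
  fixes E F :: "real mat"
  assumes E: "E \<in> carrier_mat m k" and F: "F \<in> carrier_mat m l"
    and EE: "E\<^sup>T * E = 1\<^sub>m k" and FF: "F\<^sup>T * F = 1\<^sub>m l"
    and kl: "k \<le> l" and klm: "k + l \<le> m"
    and N: "N = frame_op E a' a * frame_op F b' b \<or> N = frame_op F b' b * frame_op E a' a"
    and k1: "2 * k1 = (a' - a) * (b' - b)" and k2: "2 * k2 = - (a' * b + a * b')"
    and r: "r\<^sup>2 = a * a' * b * b'"
    and cs: "cs = image_mset sqrt (proots (char_poly ((F\<^sup>T * E)\<^sup>T * (F\<^sup>T * E))))"
  shows "eigenvalues_mset N = (\<Sum>c\<in>#cs. {# lambda1 k1 k2 r c, lambda2 k1 k2 r c #})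
      + (replicate_mset (m - l - k) (complex_of_real (a * b))
         + replicate_mset (l - k) (complex_of_real (a * b')))"
proof -
  interpret cp: map_poly_comm_ring_hom complex_of_real ..
  let ?R = "proots (char_poly ((F\<^sup>T * E)\<^sup>T * (F\<^sup>T * E)))"
  let ?M = "frame_op E a' a * frame_op F b' b"
  let ?q = "\<lambda>x. [:a * a' * b * b', - (a' * b + a * b' + (a' - a) * (b' - b) * x), 1:]"
  let ?l = "\<lambda>c. [:- lambda1 k1 k2 r c, 1:] * [:- lambda2 k1 k2 r c, 1:]"
  note carr = frame_op_carrier[OF E] frame_op_carrier[OF F]
  have M: "?M \<in> carrier_mat m m" by (rule mult_carrier_mat[OF carr])
  have "(frame_op E a' a * frame_op F b' b)\<^sup>T = frame_op F b' b * frame_op E a' a"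
    using transpose_mult[OF carr] by (simp add: frame_op_symmetric[OF E] frame_op_symmetric[OF F])
  then have NM: "N \<in> carrier_mat m m" "char_poly N = char_poly ?M"
    using N M char_poly_transpose_mat[OF M] by (metis transpose_carrier_mat)+
  have q: "map_poly complex_of_real (?q x) = ?l (sqrt x)" if "x \<in># ?R" for x
  proof -
    have "0 \<le> x" using singular_value_square_bounds[OF E F EE FF that] by simp
    moreover have "(a' - a) * (b' - b) * x = 2 * k1 * x" by (simp add: k1)
    ultimately have "a' * b + a * b' + (a' - a) * (b' - b) * x = 2 * (k1 * (sqrt x)\<^sup>2 - k2)"
      using k2 by (simp add: algebra_simps)
    from lambda_factorization[OF r this] show ?thesis by (simp add: map_poly_pCons)
  qed
  have "map_poly complex_of_real (\<Prod>x\<in>#A. ?q x) = (\<Prod>x\<in>#A. map_poly complex_of_real (?q x))" for A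
    by (induction A) (simp_all only: image_mset_empty prod_mset_empty image_mset_add_mset
        prod_mset.add_mset cp.hom_mult cp.hom_one)
  also have "(\<Prod>x\<in>#?R. map_poly complex_of_real (?q x)) = (\<Prod>c\<in>#cs. ?l c)"
    unfolding cs image_mset.compositionality o_def
    by (intro arg_cong[of _ _ prod_mset] image_mset_cong q)
  finally have prod: "map_poly complex_of_real (\<Prod>x\<in>#?R. ?q x) = (\<Prod>c\<in>#cs. ?l c)" .
  have lin: "map_poly complex_of_real [:- u, 1:] = [:- complex_of_real u, 1:]" for u
    by (simp add: map_poly_pCons)
  have "char_poly (map_mat complex_of_real N) = map_poly complex_of_real (char_poly ?M)"
    using of_real_hom.char_poly_hom[OF NM(1)] NM(2) by simp
  also have "\<dots> = [:- complex_of_real (a * b), 1:] ^ (m - l - k) *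
      [:- complex_of_real (a * b'), 1:] ^ (l - k) * (\<Prod>c\<in>#cs. ?l c)"
    unfolding char_poly_frame_product[OF E F FF EE kl klm]
    by (simp only: cp.hom_mult cp.hom_power prod lin)
  finally have cpN: "char_poly (map_mat complex_of_real N) = \<dots>" .
  have nz: "(\<Prod>c\<in>#A. ?l c) \<noteq> 0" for A
    by (induction A) (simp_all del: mult_pCons_left)
  have lnz1: "[:- u, 1:] ^ i \<noteq> 0" and lnz: "[:- u, 1:] ^ i * [:- v, 1:] ^ j \<noteq> 0" for u v :: complex and i j
    by simp_all
  have roots: "proots (\<Prod>c\<in>#A. ?l c) = (\<Sum>c\<in>#A. {# lambda1 k1 k2 r c, lambda2 k1 k2 r c #})" for A
  proof (induction A)
    case (add c A)
    have "proots (\<Prod>c\<in>#add_mset c A. ?l c) = proots (?l c) + proots (\<Prod>c\<in>#A. ?l c)"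
      unfolding image_mset_add_mset prod_mset.add_mset
      by (rule proots_mult[OF _ nz]) (simp del: mult_pCons_left)
    also have "proots (?l c) = {# lambda1 k1 k2 r c, lambda2 k1 k2 r c #}"
      by (subst proots_mult) (simp_all del: mult_pCons_left)
    finally show ?case using add by simp
  qed simp
  show ?thesis
    unfolding eigenvalues_mset_def cpN
    using proots_mult[OF lnz nz[of cs]] proots_mult[OF lnz1 lnz1]
    by (simp only: roots proots_power proots_linear_factor minus_minus repeat_mset_replicate_mset
        replicate_mset_0 replicate_mset_Suc union_commute)
qed

section \<open>Coordinate frames and the blocks of an orthogonal matrix\<close>

text \<open>The first \<open>p\<close>, respectively last \<open>n\<close>, coordinate vectors as columns. They are written as
  block matrices with an empty second block column, so that multiplying by them is block
  multiplication.\<close>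
definition top_frame :: "nat \<Rightarrow> nat \<Rightarrow> real mat" where
  "top_frame p n = four_block_mat (1\<^sub>m p) (0\<^sub>m p 0) (0\<^sub>m n p) (0\<^sub>m n 0)"

definition bottom_frame :: "nat \<Rightarrow> nat \<Rightarrow> real mat" where
  "bottom_frame p n = four_block_mat (0\<^sub>m p n) (0\<^sub>m p 0) (1\<^sub>m n) (0\<^sub>m n 0)"

lemma frame_carrier:
  "top_frame p n \<in> carrier_mat (p + n) p" "bottom_frame p n \<in> carrier_mat (p + n) n"
  by (auto simp: top_frame_def bottom_frame_def)

lemma top_frame_transpose: "(top_frame p n)\<^sup>T = four_block_mat (1\<^sub>m p) (0\<^sub>m p n) (0\<^sub>m 0 p) (0\<^sub>m 0 n)"
  unfolding top_frame_def by (subst transpose_four_block_mat[of _ p p _ 0 _ n]) auto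

lemma bottom_frame_transpose: "(bottom_frame p n)\<^sup>T = four_block_mat (0\<^sub>m n p) (1\<^sub>m n) (0\<^sub>m 0 p) (0\<^sub>m 0 n)"
  unfolding bottom_frame_def by (subst transpose_four_block_mat[of _ p n _ 0 _ n]) auto

lemma four_block_empty:
  assumes "A \<in> carrier_mat r c"
  shows "four_block_mat A (0\<^sub>m r 0) (0\<^sub>m 0 c) (0\<^sub>m 0 0) = A"
  by (rule eq_matI) (use assms in auto)

lemma top_frame_corner:
  assumes "G1 \<in> carrier_mat p2 p1" "G2 \<in> carrier_mat p2 n1" "G3 \<in> carrier_mat n2 p1" "G4 \<in> carrier_mat n2 n1"
  shows "(top_frame p2 n2)\<^sup>T * four_block_mat G1 G2 G3 G4 * top_frame p1 n1 = G1"
proof -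
  have "(top_frame p2 n2)\<^sup>T * four_block_mat G1 G2 G3 G4 = four_block_mat G1 G2 (0\<^sub>m 0 p1) (0\<^sub>m 0 n1)"
    unfolding top_frame_transpose
    by (subst mult_four_block_mat[of _ p2 p2 _ n2 _ 0 _ _ p1 _ n1]) (use assms in auto)
  also have "\<dots> * top_frame p1 n1 = four_block_mat G1 (0\<^sub>m p2 0) (0\<^sub>m 0 p1) (0\<^sub>m 0 0)"
    unfolding top_frame_def
    by (subst mult_four_block_mat[of _ p2 p1 _ n1 _ 0 _ _ p1 _ 0]) (use assms in auto)
  finally show ?thesis using four_block_empty[OF assms(1)] by simp
qed

lemma bottom_frame_corner:
  assumes "G1 \<in> carrier_mat p2 p1" "G2 \<in> carrier_mat p2 n1" "G3 \<in> carrier_mat n2 p1" "G4 \<in> carrier_mat n2 n1"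
  shows "(bottom_frame p2 n2)\<^sup>T * four_block_mat G1 G2 G3 G4 * bottom_frame p1 n1 = G4"
proof -
  have "(bottom_frame p2 n2)\<^sup>T * four_block_mat G1 G2 G3 G4 = four_block_mat G3 G4 (0\<^sub>m 0 p1) (0\<^sub>m 0 n1)"
    unfolding bottom_frame_transpose
    by (subst mult_four_block_mat[of _ n2 p2 _ n2 _ 0 _ _ p1 _ n1]) (use assms in auto)
  also have "\<dots> * bottom_frame p1 n1 = four_block_mat G4 (0\<^sub>m n2 0) (0\<^sub>m 0 n1) (0\<^sub>m 0 0)"
    unfolding bottom_frame_def
    by (subst mult_four_block_mat[of _ n2 p1 _ n1 _ 0 _ _ n1 _ 0]) (use assms in auto)
  finally show ?thesis using four_block_empty[OF assms(4)] by simp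
qed

lemma frame_orthonormal:
  "(top_frame p n)\<^sup>T * top_frame p n = 1\<^sub>m p" "(bottom_frame p n)\<^sup>T * bottom_frame p n = 1\<^sub>m n"
proof -
  \<comment> \<open>The inner products of the frame with itself form a corner of the identity matrix.\<close>
  have one: "four_block_mat (1\<^sub>m p) (0\<^sub>m p n) (0\<^sub>m n p) (1\<^sub>m n) = (1\<^sub>m (p + n) :: real mat)" by simp
  show "(top_frame p n)\<^sup>T * top_frame p n = 1\<^sub>m p"
    using top_frame_corner[of "1\<^sub>m p" p p "0\<^sub>m p n" n "0\<^sub>m n p" n "1\<^sub>m n"] frame_carrier[of p n]
    by (simp only: one one_carrier_mat zero_carrier_mat right_mult_one_mat[of _ p "p + n"] transpose_carrier_mat)
  show "(bottom_frame p n)\<^sup>T * bottom_frame p n = 1\<^sub>m n"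
    using bottom_frame_corner[of "1\<^sub>m p" p p "0\<^sub>m p n" n "0\<^sub>m n p" n "1\<^sub>m n"] frame_carrier[of p n]
    by (simp only: one one_carrier_mat zero_carrier_mat right_mult_one_mat[of _ n "p + n"] transpose_carrier_mat)
qed

text \<open>The same diagonal matrix can be read from its positive block or from its negative block; the
  first reading leads to the singular values of \<open>G1\<close>, the second to those of \<open>G4\<close>.\<close>
lemma H_mat_frame_op:
  "H_mat p n pb nb = frame_op (top_frame p n) pb (- nb)"
  "H_mat p n pb nb = frame_op (bottom_frame p n) (- nb) pb"
proof -
  have t: "top_frame p n * (top_frame p n)\<^sup>T = four_block_mat (1\<^sub>m p) (0\<^sub>m p n) (0\<^sub>m n p) (0\<^sub>m n n)"
    unfolding top_frame_transpose unfolding top_frame_def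
    by (subst mult_four_block_mat[of _ p p _ 0 _ n _ _ p _ n]) auto
  have b: "bottom_frame p n * (bottom_frame p n)\<^sup>T = four_block_mat (0\<^sub>m p p) (0\<^sub>m p n) (0\<^sub>m n p) (1\<^sub>m n)"
    unfolding bottom_frame_transpose unfolding bottom_frame_def
    by (subst mult_four_block_mat[of _ p n _ 0 _ n _ _ p _ n]) auto
  show "H_mat p n pb nb = frame_op (top_frame p n) pb (- nb)"
    unfolding frame_op_def t using frame_carrier(1)[of p n]
    by (intro eq_matI) (auto simp: H_mat_def)
  show "H_mat p n pb nb = frame_op (bottom_frame p n) (- nb) pb"
    unfolding frame_op_def b using frame_carrier(2)[of p n]
    by (intro eq_matI) (auto simp: H_mat_def)
qed

lemma frame_op_congruence:
  assumes V: "real_orthogonal_mat m V" and K: "K \<in> carrier_mat m k"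
  shows "V\<^sup>T * frame_op K a' a * V = frame_op (V\<^sup>T * K) a' a"
proof -
  have Vc: "V \<in> carrier_mat m m" and VV: "V\<^sup>T * V = 1\<^sub>m m"
    using V by (auto simp: real_orthogonal_mat_def)
  have VT: "V\<^sup>T \<in> carrier_mat m m" and KT: "K\<^sup>T \<in> carrier_mat k m" using Vc K by auto
  have P: "K * K\<^sup>T \<in> carrier_mat m m" by (rule mult_carrier_mat[OF K KT])
  have VK: "V\<^sup>T * K \<in> carrier_mat m k" by (rule mult_carrier_mat[OF VT K])
  have "V\<^sup>T * frame_op K a' a = a \<cdot>\<^sub>m V\<^sup>T + (a' - a) \<cdot>\<^sub>m (V\<^sup>T * (K * K\<^sup>T))"
    unfolding frame_op_def
    using K mult_add_distrib_mat[OF VT smult_carrier_mat[OF one_carrier_mat] smult_carrier_mat[OF P], of a "a' - a"]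
      mult_smult_distrib[OF VT one_carrier_mat, of a] mult_smult_distrib[OF VT P, of "a' - a"] right_mult_one_mat[OF VT]
    by simp
  also have "\<dots> * V = a \<cdot>\<^sub>m 1\<^sub>m m + (a' - a) \<cdot>\<^sub>m (V\<^sup>T * (K * K\<^sup>T) * V)"
    using add_mult_distrib_mat[OF smult_carrier_mat[OF VT] smult_carrier_mat[OF mult_carrier_mat[OF VT P]] Vc, of a "a' - a"]
      mult_smult_assoc_mat[OF VT Vc, of a] mult_smult_assoc_mat[OF mult_carrier_mat[OF VT P] Vc, of "a' - a"]
    by (simp only: VV)
  also have "V\<^sup>T * (K * K\<^sup>T) * V = (V\<^sup>T * K) * (V\<^sup>T * K)\<^sup>T"
    using assoc_mult_mat[OF VT K KT] assoc_mult_mat[OF VK KT Vc] transpose_mult[OF VT K] by simp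
  finally show ?thesis using Vc by (simp add: frame_op_def)
qed

lemma orthogonal_transport_frame:
  assumes V: "real_orthogonal_mat m V" and K: "K \<in> carrier_mat m k" and KK: "K\<^sup>T * K = 1\<^sub>m k"
  shows "V\<^sup>T * K \<in> carrier_mat m k" and "(V\<^sup>T * K)\<^sup>T * (V\<^sup>T * K) = 1\<^sub>m k"
proof -
  have Vc: "V \<in> carrier_mat m m" and VV: "V * V\<^sup>T = 1\<^sub>m m"
    using V by (auto simp: real_orthogonal_mat_def)
  have VT: "V\<^sup>T \<in> carrier_mat m m" and KT: "K\<^sup>T \<in> carrier_mat k m" using Vc K by auto
  show VK: "V\<^sup>T * K \<in> carrier_mat m k" by (rule mult_carrier_mat[OF VT K])
  have "(V\<^sup>T * K)\<^sup>T * (V\<^sup>T * K) = K\<^sup>T * (V * (V\<^sup>T * K))"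
    using transpose_mult[OF VT K] assoc_mult_mat[OF KT Vc VK] by simp
  also have "V * (V\<^sup>T * K) = K"
    using assoc_mult_mat[OF Vc VT K] K by (simp add: VV)
  finally show "(V\<^sup>T * K)\<^sup>T * (V\<^sup>T * K) = 1\<^sub>m k" by (simp add: KK)
qed

text \<open>This is how the blocks of \<open>V2 * V1\<^sup>T\<close> arise: as the mutual inner products of the two
  transported coordinate frames.\<close>
lemma cross_gram_transport:
  fixes V1 V2 K1 K2 :: "'a :: comm_semiring_1 mat"
  assumes V1: "V1 \<in> carrier_mat m m" and V2: "V2 \<in> carrier_mat m m"
    and K1: "K1 \<in> carrier_mat m k" and K2: "K2 \<in> carrier_mat m l"
  shows "(V2\<^sup>T * K2)\<^sup>T * (V1\<^sup>T * K1) = K2\<^sup>T * (V2 * V1\<^sup>T) * K1"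
proof -
  have T: "V1\<^sup>T \<in> carrier_mat m m" "V2\<^sup>T \<in> carrier_mat m m" "K2\<^sup>T \<in> carrier_mat l m"
    using assms by auto
  show ?thesis
    using transpose_mult[OF T(2) K2] assoc_mult_mat[OF mult_carrier_mat[OF T(3) V2] T(1) K1]
      assoc_mult_mat[OF T(3) V2 T(1)] by simp
qed

lemma N_mat_frame_ops:
  assumes V1: "real_orthogonal_mat m V1" and V2: "real_orthogonal_mat m V2"
    and K1: "K1 \<in> carrier_mat m k" and K2: "K2 \<in> carrier_mat m l"
    and D1: "diag_of_vec \<alpha>1 = frame_op K1 a' a" and D2: "diag_of_vec \<alpha>2 = frame_op K2 b' b"
  shows "N_mat V1 V2 \<alpha>1 \<alpha>2 = frame_op (V1\<^sup>T * K1) a' a * frame_op (V2\<^sup>T * K2) b' b"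
proof -
  have c: "V1 \<in> carrier_mat m m" "V2 \<in> carrier_mat m m" "V1\<^sup>T \<in> carrier_mat m m" "V2\<^sup>T \<in> carrier_mat m m"
    using V1 V2 by (auto simp: real_orthogonal_mat_def)
  have d: "frame_op K1 a' a \<in> carrier_mat m m" "frame_op K2 b' b \<in> carrier_mat m m"
    using frame_op_carrier K1 K2 by blast+
  have X: "V1\<^sup>T * frame_op K1 a' a * V1 \<in> carrier_mat m m"
    by (intro mult_carrier_mat[of _ m m] c d)
  show ?thesis
    unfolding N_mat_def D1 D2
      frame_op_congruence[OF V1 K1, symmetric] frame_op_congruence[OF V2 K2, symmetric]
    using assoc_mult_mat[OF X c(4) d(2)] assoc_mult_mat[OF X mult_carrier_mat[OF c(4) d(2)] c(2)]
    by simp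
qed

section \<open>The spectrum of the product\<close>

text \<open>The conclusion of the theorem with the positive and negative blocks and the two factors made
  anonymous, so that it covers each choice of the smallest of the four blocks.\<close>
lemma spectrum_of_frame_product:
  fixes E F :: "real mat"
  assumes E: "E \<in> carrier_mat m k" and F: "F \<in> carrier_mat m l"
    and EE: "E\<^sup>T * E = 1\<^sub>m k" and FF: "F\<^sup>T * F = 1\<^sub>m l"
    and kl: "k \<le> l" and klm: "k + l \<le> m"
    and N: "N = frame_op E a' a * frame_op F b' b \<or> N = frame_op F b' b * frame_op E a' a"
    and k1: "2 * k1 = (a' - a) * (b' - b)" and k2: "2 * k2 = - (a' * b + a * b')"
    and r: "r\<^sup>2 = a * a' * b * b'"
    and cs: "cs = image_mset sqrt (proots (char_poly ((F\<^sup>T * E)\<^sup>T * (F\<^sup>T * E))))"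
    and pos: "a * b \<in> Pos" and neg: "a * b' \<in> Neg"
  shows "size cs = k
    \<and> (\<forall>c \<in># cs. 0 \<le> c \<and> c \<le> 1)
    \<and> (\<forall>c \<in># cs. (k1 * c\<^sup>2 - k2)\<^sup>2 \<noteq> r\<^sup>2 \<longrightarrow> lambda1 k1 k2 r c \<noteq> lambda2 k1 k2 r c)
    \<and> (\<exists>R. eigenvalues_mset N =
             (\<Sum>c \<in># cs. {# lambda1 k1 k2 r c, lambda2 k1 k2 r c #}) + R
         \<and> size R + 2 * k = m
         \<and> (\<exists>pos \<in> Pos. \<exists>neg \<in> Neg.
              set_mset R \<subseteq> {complex_of_real pos, complex_of_real neg}))"
proof (intro conjI)
  have X: "F\<^sup>T * E \<in> carrier_mat l k" using E F by auto
  have C: "(F\<^sup>T * E)\<^sup>T * (F\<^sup>T * E) \<in> carrier_mat k k"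
    by (rule mult_carrier_mat[OF _ X]) (use E F in simp)
  have "((F\<^sup>T * E)\<^sup>T * (F\<^sup>T * E))\<^sup>T = (F\<^sup>T * E)\<^sup>T * (F\<^sup>T * E)"
    using transpose_mult[of "(F\<^sup>T * E)\<^sup>T" k l "F\<^sup>T * E" k] X by simp
  from real_symmetric_char_poly_splits(2)[OF C this] show "size cs = k" by (simp add: cs)
  show "\<forall>c \<in># cs. 0 \<le> c \<and> c \<le> 1"
    using singular_value_square_bounds[OF E F EE FF] by (auto simp: cs)
  show "\<forall>c \<in># cs. (k1 * c\<^sup>2 - k2)\<^sup>2 \<noteq> r\<^sup>2 \<longrightarrow> lambda1 k1 k2 r c \<noteq> lambda2 k1 k2 r c"
    using lambda_distinct by blast
  let ?R = "replicate_mset (m - l - k) (complex_of_real (a * b)) + replicate_mset (l - k) (complex_of_real (a * b'))"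
  have "size ?R + 2 * k = m" using kl klm by simp
  moreover have "set_mset ?R \<subseteq> {complex_of_real (a * b), complex_of_real (a * b')}"
    by (auto split: if_splits)
  ultimately show "\<exists>R. eigenvalues_mset N =
             (\<Sum>c \<in># cs. {# lambda1 k1 k2 r c, lambda2 k1 k2 r c #}) + R
         \<and> size R + 2 * k = m
         \<and> (\<exists>pos \<in> Pos. \<exists>neg \<in> Neg. set_mset R \<subseteq> {complex_of_real pos, complex_of_real neg})"
    using eigenvalues_frame_product[OF assms(1-11)] pos neg by blast
qed

theorem theorem1:
  fixes m p1 n1 p2 n2 p :: nat
    and V1 V2 G1 G2 G3 G4 :: "real mat"
    and \<alpha>1 \<alpha>2 :: "real vec"
    and pb1 nb1 pb2 nb2 nbar pbar rbar nbreve pbreve k1 k2 :: real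
    and cs :: "real multiset"
  assumes V1: "real_orthogonal_mat m V1"
    and V2: "real_orthogonal_mat m V2"
    and \<alpha>1: "\<alpha>1 \<in> carrier_vec m"
    and \<alpha>2: "\<alpha>2 \<in> carrier_vec m"
    and pn1: "p1 + n1 = m"
    and pn2: "p2 + n2 = m"
    and nonneg: "pb1 \<ge> 0" "nb1 \<ge> 0" "pb2 \<ge> 0" "nb2 \<ge> 0"
    and H1: "diag_of_vec \<alpha>1 = H_mat p1 n1 pb1 nb1"
    and H2: "diag_of_vec \<alpha>2 = H_mat p2 n2 pb2 nb2"
    and G1: "G1 \<in> carrier_mat p2 p1"
    and G2: "G2 \<in> carrier_mat p2 n1"
    and G3: "G3 \<in> carrier_mat n2 p1"
    and G4: "G4 \<in> carrier_mat n2 n1"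
    and G: "V2 * transpose_mat V1 = four_block_mat G1 G2 G3 G4"
    and cs: "cs = singular_values (if min p1 p2 \<le> min n1 n2 then G1 else G4)"
    and p: "p = min (min p1 p2) (min n1 n2)"
    and nbar: "nbar = max (pb1 * nb2) (nb1 * pb2)"
    and pbar: "pbar = max (pb1 * pb2) (nb1 * nb2)"
    and rbar: "rbar = sqrt (pb1 * nb1 * nb2 * pb2)"
    and nbreve: "nbreve = min (pb1 * nb2) (nb1 * pb2)"
    and pbreve: "pbreve = min (pb1 * pb2) (nb1 * nb2)"
    and k1: "k1 = 1 / 2 * (pb1 + nb1) * (pb2 + nb2)"
    and k2: "k2 = 1 / 2 * (pb1 * nb2 + nb1 * pb2)"
  shows "size cs = p
    \<and> (\<forall>c \<in># cs. 0 \<le> c \<and> c \<le> 1)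
    \<and> (\<forall>c \<in># cs. (k1 * c\<^sup>2 - k2)\<^sup>2 \<noteq> rbar\<^sup>2 \<longrightarrow>
          lambda1 k1 k2 rbar c \<noteq> lambda2 k1 k2 rbar c)
    \<and> (\<exists>R. eigenvalues_mset (N_mat V1 V2 \<alpha>1 \<alpha>2) =
             (\<Sum>c \<in># cs. {# lambda1 k1 k2 rbar c, lambda2 k1 k2 rbar c #}) + R
         \<and> size R + 2 * p = m
         \<and> (\<exists>pos \<in> {pbar, pbreve}. \<exists>neg \<in> {- nbar, - nbreve}.
              set_mset R \<subseteq> {complex_of_real pos, complex_of_real neg}))"
proof -
  define T1 B1 T2 B2 where "T1 = V1\<^sup>T * top_frame p1 n1" and "B1 = V1\<^sup>T * bottom_frame p1 n1"
    and "T2 = V2\<^sup>T * top_frame p2 n2" and "B2 = V2\<^sup>T * bottom_frame p2 n2"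
  let ?N = "N_mat V1 V2 \<alpha>1 \<alpha>2"
  have fc: "top_frame p1 n1 \<in> carrier_mat m p1" "bottom_frame p1 n1 \<in> carrier_mat m n1"
    "top_frame p2 n2 \<in> carrier_mat m p2" "bottom_frame p2 n2 \<in> carrier_mat m n2"
    using frame_carrier[of p1 n1] frame_carrier[of p2 n2] by (simp_all add: pn1 pn2)
  note T1 = orthogonal_transport_frame[OF V1 fc(1) frame_orthonormal(1), folded T1_def]
  note B1 = orthogonal_transport_frame[OF V1 fc(2) frame_orthonormal(2), folded B1_def]
  note T2 = orthogonal_transport_frame[OF V2 fc(3) frame_orthonormal(1), folded T2_def]
  note B2 = orthogonal_transport_frame[OF V2 fc(4) frame_orthonormal(2), folded B2_def]
  have Vc: "V1 \<in> carrier_mat m m" "V2 \<in> carrier_mat m m"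
    using V1 V2 by (auto simp: real_orthogonal_mat_def)
  have TT: "T2\<^sup>T * T1 = G1"
    unfolding T1_def T2_def cross_gram_transport[OF Vc fc(1) fc(3)] G
    by (rule top_frame_corner[OF G1 G2 G3 G4])
  have BB: "B2\<^sup>T * B1 = G4"
    unfolding B1_def B2_def cross_gram_transport[OF Vc fc(2) fc(4)] G
    by (rule bottom_frame_corner[OF G1 G2 G3 G4])
  have TT': "T1\<^sup>T * T2 = G1\<^sup>T"
    using transpose_mult[of "T2\<^sup>T" p2 m T1 p1] T1 T2 by (simp flip: TT)
  have BB': "B1\<^sup>T * B2 = G4\<^sup>T"
    using transpose_mult[of "B2\<^sup>T" n2 m B1 n1] B1 B2 by (simp flip: BB)
  have N_top: "?N = frame_op T1 pb1 (- nb1) * frame_op T2 pb2 (- nb2)"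
    unfolding T1_def T2_def
    by (rule N_mat_frame_ops[OF V1 V2 fc(1) fc(3)]) (simp_all add: H1 H2 H_mat_frame_op(1))
  have N_bot: "?N = frame_op B1 (- nb1) pb1 * frame_op B2 (- nb2) pb2"
    unfolding B1_def B2_def
    by (rule N_mat_frame_ops[OF V1 V2 fc(2) fc(4)]) (simp_all add: H1 H2 H_mat_frame_op(2))
  have r: "rbar\<^sup>2 = pb1 * nb1 * nb2 * pb2" using nonneg by (simp add: rbar)
  have mem: "nb1 * nb2 \<in> {pbar, pbreve}" "nb2 * nb1 \<in> {pbar, pbreve}"
    "pb1 * pb2 \<in> {pbar, pbreve}" "pb2 * pb1 \<in> {pbar, pbreve}"
    "- nb1 * pb2 \<in> {- nbar, - nbreve}" "- nb2 * pb1 \<in> {- nbar, - nbreve}"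
    "- (pb1 * nb2) \<in> {- nbar, - nbreve}" "- (pb2 * nb1) \<in> {- nbar, - nbreve}"
    by (auto simp: pbar pbreve nbar nbreve max_def min_def mult.commute)
  \<comment> \<open>In each case \<open>E\<close> is a frame with \<open>p\<close> columns, the least of the four block sizes, and \<open>F\<close> is
    the frame of the same sign of the other factor. If \<open>F\<close> has \<open>l\<close> columns, then the block of opposite
    sign in its factor has size \<open>m - l\<close>, so \<open>p \<le> m - l\<close>.\<close>
  consider (T12) "min p1 p2 \<le> min n1 n2" "p1 \<le> p2" | (T21) "min p1 p2 \<le> min n1 n2" "\<not> p1 \<le> p2"
    | (B12) "\<not> min p1 p2 \<le> min n1 n2" "n1 \<le> n2" | (B21) "\<not> min p1 p2 \<le> min n1 n2" "\<not> n1 \<le> n2"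
    by blast
  then show ?thesis
  proof cases
    case T12
    have "p = p1" using T12 p by simp
    show ?thesis unfolding \<open>p = p1\<close>
    proof (rule spectrum_of_frame_product[OF T1(1) T2(1) T1(2) T2(2) _ _ disjI1[OF N_top]])
      show "cs = image_mset sqrt (proots (char_poly ((T2\<^sup>T * T1)\<^sup>T * (T2\<^sup>T * T1))))"
        using T12 G1 by (simp add: cs TT singular_values_def)
    qed (use T12 pn1 pn2 mem in \<open>auto simp: k1 k2 r algebra_simps\<close>)
  next
    case T21
    have "p = p2" using T21 p by simp
    show ?thesis unfolding \<open>p = p2\<close>
    proof (rule spectrum_of_frame_product[OF T2(1) T1(1) T2(2) T1(2) _ _ disjI2[OF N_top]])
      show "cs = image_mset sqrt (proots (char_poly ((T1\<^sup>T * T2)\<^sup>T * (T1\<^sup>T * T2))))"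
        using T21 G1 by (simp add: cs TT' singular_values_def)
    qed (use T21 pn1 pn2 mem in \<open>auto simp: k1 k2 r algebra_simps\<close>)
  next
    case B12
    have "p = n1" using B12 p by simp
    show ?thesis unfolding \<open>p = n1\<close>
    proof (rule spectrum_of_frame_product[OF B1(1) B2(1) B1(2) B2(2) _ _ disjI1[OF N_bot]])
      show "cs = image_mset sqrt (proots (char_poly ((B2\<^sup>T * B1)\<^sup>T * (B2\<^sup>T * B1))))"
        using B12 G4 by (simp add: cs BB singular_values_def)
    qed (use B12 pn1 pn2 mem in \<open>auto simp: k1 k2 r algebra_simps\<close>)
  next
    case B21
    have "p = n2" using B21 p by simp
    show ?thesis unfolding \<open>p = n2\<close>
    proof (rule spectrum_of_frame_product[OF B2(1) B1(1) B2(2) B1(2) _ _ disjI2[OF N_bot]])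
      show "cs = image_mset sqrt (proots (char_poly ((B1\<^sup>T * B2)\<^sup>T * (B1\<^sup>T * B2))))"
        using B21 G4 by (simp add: cs BB' singular_values_def)
    qed (use B21 pn1 pn2 mem in \<open>auto simp: k1 k2 r algebra_simps\<close>)
  qed
qed

end
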